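(* Let $\mathbb K$ be a field and let $A,A^*$ be a Leonard pair over $\mathbb K$. Then there exists at most one Leonard system which is associated with $A,A^*$ and which is in $TD$-$D$ canonical form.
   Context: $\mathrm{Mat}_{d+1}(\mathbb K)$ is the algebra of $(d+1)\times(d+1)$ matrices over $\mathbb K$, rows and columns indexed by $0,1,\dots,d$. A matrix is tridiagonal if every nonzero entry lies on the diagonal, subdiagonal or superdiagonal. Leonard pairs and systems. Let $\mathcal A$ be a $\mathbb K$-algebra isomorphic to $\mathrm{Mat}_{d+1}(\mathbb K)$, $d\ge0$. An element $A\in\mathcal A$ is multiplicity-free if it has $d+1$ distinct eigenvalues in $\mathbb K$; if these are $\theta_0,\dots,\theta_d$, the primitive idempotent of $A$ associated with $\theta_i$ is $E_i=\prod_{j\ne i}(A-\theta_jI)/(\theta_i-\theta_j)$. For multiplicity-free $A,A^*\in\mathcal A$ ($A^*$ is just a name, not an adjoint), an idempotent sequence for $A,A^*$ is an ordering $E_0,\dots,E_d$ of the primitive idempotents of $A$ such that $E_iA^*E_j=0$ if $|i-j|>1$ and $E_iA^*E_j\ne0$ if $|i-j|=1$ ($0\le i,j\le d$); a dual idempotent sequence for $A,A^*$ is an idempotent sequence for $A^*,A$. A Leonard pair in $\mathcal A$ (over $\mathbb K$) is an ordered pair $A,A^*$ of multiplicity-free elements of $\mathcal A$ for which an idempotent sequence and a dual idempotent sequence exist. A Leonard system in $\mathcal A$ (ambient algebra $\mathcal A$) is a sequence $\Phi=(A,A^*;E_i,E^*_i,i=0..d)$ where $A,A^*\in\mathcal A$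 are multiplicity-free, $E_0,\dots,E_d$ is an idempotent sequence for $A,A^*$ and $E^*_0,\dots,E^*_d$ is a dual idempotent sequence for $A,A^*$; then $A,A^*$ is a Leonard pair, said to be associated with $\Phi$ (and $\Phi$ with it). The eigenvalue sequence (resp. dual eigenvalue sequence) of $\Phi$ is $\theta_0,\dots,\theta_d$ (resp. $\theta^*_0,\dots,\theta^*_d$), where $\theta_i$ (resp. $\theta^*_i$) is the eigenvalue of $A$ (resp. $A^*$) associated with $E_i$ (resp. $E^*_i$). A Leonard system with eigenvalue sequence $\theta_0,\dots,\theta_d$ and dual eigenvalue sequence $\theta^*_0,\dots,\theta^*_d$ is in $TD$-$D$ canonical form if its ambient algebra is $\mathrm{Mat}_{d+1}(\mathbb K)$, $A$ is tridiagonal and $A^*$ is diagonal, every row sum of $A$ equals $\theta_0$, and $A^*_{00}=\theta^*_0$. *)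

theory Defs
  imports
    "Jordan_Normal_Form.Char_Poly"
    "Jordan_Normal_Form.VS_Connect"
    "HOL-Algebra.QuotRing"
begin

abbreviation Mat_alg :: "nat \<Rightarrow> ('k::field, 'k mat) module" where
  "Mat_alg d \<equiv> module_mat TYPE('k) (d + 1) (d + 1)"

text \<open>HOL-Algebra's locale \<open>algebra\<close> is restricted to commutative algebras, so the notion of an
  associative unital \<open>\<bbbK>\<close>-algebra is spelled out here. The field \<open>\<bbbK>\<close> is the type \<open>'k\<close>, viewed as a
  ring through \<open>class_ring\<close>.\<close>

definition k_algebra :: "('k::field, 'b) module \<Rightarrow> bool" where
  "k_algebra R \<longleftrightarrow> ring R \<and> vectorspace class_ring R \<and>
     (\<forall>c. \<forall>x\<in>carrier R. \<forall>y\<in>carrier R.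
        (c \<odot>\<^bsub>R\<^esub> x) \<otimes>\<^bsub>R\<^esub> y = c \<odot>\<^bsub>R\<^esub> (x \<otimes>\<^bsub>R\<^esub> y) \<and>
        x \<otimes>\<^bsub>R\<^esub> (c \<odot>\<^bsub>R\<^esub> y) = c \<odot>\<^bsub>R\<^esub> (x \<otimes>\<^bsub>R\<^esub> y))"

definition mat_isos :: "nat \<Rightarrow> ('k::field, 'b) module \<Rightarrow> ('b \<Rightarrow> 'k mat) set" where
  "mat_isos d R = {h \<in> ring_iso R (Mat_alg d). \<forall>c. \<forall>x\<in>carrier R. h (c \<odot>\<^bsub>R\<^esub> x) = c \<cdot>\<^sub>m h x}"

definition matrix_algebra :: "nat \<Rightarrow> ('k::field, 'b) module \<Rightarrow> bool" where
  "matrix_algebra d R \<longleftrightarrow> k_algebra R \<and> mat_isos d R \<noteq> {}"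

text \<open>The eigenvalues of an element of an abstract matrix algebra are those of the matrix
  representing it; by \<open>alg_eigenvalue_iff\<close> below the isomorphism does not matter.\<close>

definition alg_eigenvalue :: "nat \<Rightarrow> ('k::field, 'b) module \<Rightarrow> 'b \<Rightarrow> 'k \<Rightarrow> bool" where
  "alg_eigenvalue d R A \<theta> \<longleftrightarrow> (\<exists>h\<in>mat_isos d R. eigenvalue (h A) \<theta>)"

definition multiplicity_free :: "nat \<Rightarrow> ('k::field, 'b) module \<Rightarrow> 'b \<Rightarrow> bool" where
  "multiplicity_free d R A \<longleftrightarrow> A \<in> carrier R \<and> card {\<theta>. alg_eigenvalue d R A \<theta>} = d + 1"

text \<open>\<open>prim_idem R A \<theta>s i\<close> is \<open>\<Prod>\<^sub>j\<^sub>\<noteq>\<^sub>i (A - \<theta>\<^sub>j I) / (\<theta>\<^sub>i - \<theta>\<^sub>j)\<close>. Since \<open>R\<close> is not commutative,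
  the product is taken over a list; its factors commute with each other.\<close>

definition prim_idem :: "('k::field, 'b) module \<Rightarrow> 'b \<Rightarrow> 'k list \<Rightarrow> nat \<Rightarrow> 'b" where
  "prim_idem R A \<theta>s i =
     foldr (\<otimes>\<^bsub>R\<^esub>)
       (map (\<lambda>j. inverse (\<theta>s ! i - \<theta>s ! j) \<odot>\<^bsub>R\<^esub> (A \<ominus>\<^bsub>R\<^esub> (\<theta>s ! j \<odot>\<^bsub>R\<^esub> \<one>\<^bsub>R\<^esub>)))
         (filter (\<lambda>j. j \<noteq> i) [0..<length \<theta>s]))
       \<one>\<^bsub>R\<^esub>"

text \<open>\<open>Es\<close> is an ordering of the primitive idempotents of \<open>A\<close>, and \<open>\<theta>s ! i\<close> is the eigenvalue of
  \<open>A\<close> associated with \<open>Es ! i\<close>.\<close>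

definition eigenvalue_seq ::
  "nat \<Rightarrow> ('k::field, 'b) module \<Rightarrow> 'b \<Rightarrow> 'b list \<Rightarrow> 'k list \<Rightarrow> bool" where
  "eigenvalue_seq d R A Es \<theta>s \<longleftrightarrow>
     length \<theta>s = d + 1 \<and> distinct \<theta>s \<and> set \<theta>s = {\<theta>. alg_eigenvalue d R A \<theta>} \<and>
     Es = map (prim_idem R A \<theta>s) [0..<d + 1]"

definition idempotent_seq ::
  "nat \<Rightarrow> ('k::field, 'b) module \<Rightarrow> 'b \<Rightarrow> 'b \<Rightarrow> 'b list \<Rightarrow> bool" where
  "idempotent_seq d R A As Es \<longleftrightarrow>
     (\<exists>\<theta>s. eigenvalue_seq d R A Es \<theta>s) \<and>
     (\<forall>i\<le>d. \<forall>j\<le>d.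
        (\<bar>int i - int j\<bar> > 1 \<longrightarrow> Es ! i \<otimes>\<^bsub>R\<^esub> As \<otimes>\<^bsub>R\<^esub> Es ! j = \<zero>\<^bsub>R\<^esub>) \<and>
        (\<bar>int i - int j\<bar> = 1 \<longrightarrow> Es ! i \<otimes>\<^bsub>R\<^esub> As \<otimes>\<^bsub>R\<^esub> Es ! j \<noteq> \<zero>\<^bsub>R\<^esub>))"

definition leonard_pair :: "nat \<Rightarrow> ('k::field, 'b) module \<Rightarrow> 'b \<Rightarrow> 'b \<Rightarrow> bool" where
  "leonard_pair d R A As \<longleftrightarrow>
     matrix_algebra d R \<and> multiplicity_free d R A \<and> multiplicity_free d R As \<and>
     (\<exists>Es. idempotent_seq d R A As Es) \<and> (\<exists>Es. idempotent_seq d R As A Es)"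

record ('k, 'b) leonard_data =
  ambient :: "('k, 'b) module"
  elt :: 'b
  dual_elt :: 'b
  idems :: "'b list"
  dual_idems :: "'b list"

definition leonard_system :: "nat \<Rightarrow> ('k::field, 'b) leonard_data \<Rightarrow> bool" where
  "leonard_system d \<Phi> \<longleftrightarrow>
     matrix_algebra d (ambient \<Phi>) \<and>
     multiplicity_free d (ambient \<Phi>) (elt \<Phi>) \<and> multiplicity_free d (ambient \<Phi>) (dual_elt \<Phi>) \<and>
     idempotent_seq d (ambient \<Phi>) (elt \<Phi>) (dual_elt \<Phi>) (idems \<Phi>) \<and>
     idempotent_seq d (ambient \<Phi>) (dual_elt \<Phi>) (elt \<Phi>) (dual_idems \<Phi>)"

definition associated ::
  "('k::field, 'b) leonard_data \<Rightarrow> ('k, 'b) module \<Rightarrow> 'b \<Rightarrow> 'b \<Rightarrow> bool" where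
  "associated \<Phi> R A As \<longleftrightarrow> ambient \<Phi> = R \<and> elt \<Phi> = A \<and> dual_elt \<Phi> = As"

definition tridiagonal_mat :: "'a::zero mat \<Rightarrow> bool" where
  "tridiagonal_mat M \<longleftrightarrow>
     (\<forall>i<dim_row M. \<forall>j<dim_col M. \<bar>int i - int j\<bar> > 1 \<longrightarrow> M $$ (i, j) = 0)"

definition TD_D_canonical :: "nat \<Rightarrow> ('k::field, 'k mat) leonard_data \<Rightarrow> bool" where
  "TD_D_canonical d \<Phi> \<longleftrightarrow>
     (\<exists>\<theta>s \<theta>ss.
        eigenvalue_seq d (ambient \<Phi>) (elt \<Phi>) (idems \<Phi>) \<theta>s \<and>
        eigenvalue_seq d (ambient \<Phi>) (dual_elt \<Phi>) (dual_idems \<Phi>) \<theta>ss \<and>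
        ambient \<Phi> = Mat_alg d \<and>
        tridiagonal_mat (elt \<Phi>) \<and> diagonal_mat (dual_elt \<Phi>) \<and>
        (\<forall>i\<le>d. (\<Sum>j\<le>d. elt \<Phi> $$ (i, j)) = \<theta>s ! 0) \<and>
        dual_elt \<Phi> $$ (0, 0) = \<theta>ss ! 0)"

lemma alg_eigenvalue_iff:
  assumes h: "h \<in> mat_isos d R" and R: "k_algebra R" and A: "A \<in> carrier R"
  shows "alg_eigenvalue d R A \<theta> \<longleftrightarrow> eigenvalue (h A) \<theta>"
proof -
  interpret ring R using R by (simp add: k_algebra_def)
  interpret V: vectorspace class_ring R using R by (simp add: k_algebra_def)
  define B where "B = A \<oplus>\<^bsub>R\<^esub> (- \<theta>) \<odot>\<^bsub>R\<^esub> \<one>\<^bsub>R\<^esub>"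
  have s: "(- \<theta>) \<odot>\<^bsub>R\<^esub> \<one>\<^bsub>R\<^esub> \<in> carrier R" by simp
  have B: "B \<in> carrier R" using A s by (simp add: B_def)
  have key: "eigenvalue (g A) \<theta> \<longleftrightarrow> B \<notin> Units R" if g: "g \<in> mat_isos d R" for g
  proof -
    have hom: "g \<in> ring_hom R (Mat_alg d)" and bij: "bij_betw g (carrier R) (carrier_mat (d+1) (d+1))"
      and sm: "\<And>c x. x \<in> carrier R \<Longrightarrow> g (c \<odot>\<^bsub>R\<^esub> x) = c \<cdot>\<^sub>m g x"
      using g by (auto simp: mat_isos_def ring_iso_def module_mat_simps)
    have g1: "g \<one>\<^bsub>R\<^esub> = 1\<^sub>m (d+1)" using ring_hom_one[OF hom] by (simp add: module_mat_simps)
    have gm: "\<And>x y. x \<in> carrier R \<Longrightarrow> y \<in> carrier R \<Longrightarrow> g (x \<otimes>\<^bsub>R\<^esub> y) = g x * g y"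
      using ring_hom_mult[OF hom] by (simp add: module_mat_simps)
    have ga: "\<And>x y. x \<in> carrier R \<Longrightarrow> y \<in> carrier R \<Longrightarrow> g (x \<oplus>\<^bsub>R\<^esub> y) = g x + g y"
      using ring_hom_add[OF hom] by (simp add: module_mat_simps)
    have gc: "\<And>x. x \<in> carrier R \<Longrightarrow> g x \<in> carrier_mat (d+1) (d+1)"
      using bij by (auto simp: bij_betw_def)
    have gB: "g B = char_matrix (g A) \<theta>"
      using A s gc[OF A] by (simp add: B_def ga sm g1 char_matrix_def)
    have "det (g B) \<noteq> 0 \<longleftrightarrow> B \<in> Units R"
    proof
      assume "det (g B) \<noteq> 0"
      then obtain C where C: "C \<in> carrier_mat (d+1) (d+1)" "g B * C = 1\<^sub>m (d+1)" "C * g B = 1\<^sub>m (d+1)"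
        using det_non_zero_imp_unit[OF gc[OF B], of undefined]
        by (auto simp: Units_def ring_mat_simps)
      then obtain c where c: "c \<in> carrier R" "C = g c" using bij by (auto simp: bij_betw_def)
      have "g (B \<otimes>\<^bsub>R\<^esub> c) = g \<one>\<^bsub>R\<^esub>" "g (c \<otimes>\<^bsub>R\<^esub> B) = g \<one>\<^bsub>R\<^esub>" using C c B by (auto simp: gm g1)
      then have "B \<otimes>\<^bsub>R\<^esub> c = \<one>\<^bsub>R\<^esub>" "c \<otimes>\<^bsub>R\<^esub> B = \<one>\<^bsub>R\<^esub>"
        using bij B c by (auto simp: bij_betw_def inj_on_def)
      then show "B \<in> Units R" using B c by (auto simp: Units_def)
    next
      assume "B \<in> Units R"
      then obtain c where c: "c \<in> carrier R" "B \<otimes>\<^bsub>R\<^esub> c = \<one>\<^bsub>R\<^esub>" by (auto simp: Units_def)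
      then have "g B * g c = 1\<^sub>m (d+1)" using gm[OF B c(1)] g1 by simp
      then have "det (g B) * det (g c) = 1" using det_mult[OF gc[OF B] gc[OF c(1)]] by simp
      then show "det (g B) \<noteq> 0" by auto
    qed
    then show ?thesis using eigenvalue_det[OF gc[OF A]] gB by auto
  qed
  show ?thesis using key h by (auto simp: alg_eigenvalue_def)
qed

end

theory Submission
  imports Defs
begin

text \<open>The two normalizations read off \<open>\<theta>\<^sub>0\<close> from row \<open>0\<close> of \<open>A\<close> and \<open>\<theta>\<^sup>*\<^sub>0\<close> from an entry of
  \<open>A\<^sup>*\<close>. An idempotent sequence is in turn determined by its first term: join two primitive
  idempotents \<open>E\<close>, \<open>F\<close> of \<open>A\<close> when \<open>E A\<^sup>* F \<noteq> 0\<close>; the resulting graph is a path traversed by the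
  sequence, and a path has only one traversal from a given end.\<close>

lemma (in monoid) foldr_mult_closed:
  "set xs \<subseteq> carrier G \<Longrightarrow> foldr (\<otimes>) xs \<one> \<in> carrier G"
  by (induction xs) auto

lemma (in monoid) foldr_mult_remove1:
  assumes "x \<in> set xs" "set xs \<subseteq> carrier G"
    and "\<And>y z. y \<in> set xs \<Longrightarrow> z \<in> set xs \<Longrightarrow> y \<otimes> z = z \<otimes> y"
  shows "foldr (\<otimes>) xs \<one> = x \<otimes> foldr (\<otimes>) (remove1 x xs) \<one>"
  using assms
proof (induction xs)
  case (Cons a xs)
  show ?case
  proof (cases "a = x")
    case False
    let ?p = "foldr (\<otimes>) (remove1 x xs) \<one>"
    have x: "x \<in> set xs" using Cons.prems(1) False by simp
    have "set (remove1 x xs) \<subseteq> carrier G"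
      using Cons.prems(2) set_remove1_subset[of x xs] by auto
    then have p: "?p \<in> carrier G" by (rule foldr_mult_closed)
    have ax: "a \<in> carrier G" "x \<in> carrier G" "a \<otimes> x = x \<otimes> a"
      using Cons.prems x by auto
    have "foldr (\<otimes>) xs \<one> = x \<otimes> ?p" using Cons.IH x Cons.prems by simp
    then have "foldr (\<otimes>) (a # xs) \<one> = (a \<otimes> x) \<otimes> ?p" using p ax(1,2) by (simp add: m_assoc)
    also have "\<dots> = x \<otimes> (a \<otimes> ?p)" unfolding ax(3) using p ax(1,2) by (simp add: m_assoc)
    finally show ?thesis using False by simp
  qed simp
qed simp

text \<open>\<open>prim_idem\<close> multiplies its factors in the order of an eigenvalue list,
  inside a noncommutative ring. Pairwise commuting factors make that order irrelevant: the head of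
  \<open>xs\<close> is pulled to the front of \<open>ys\<close>, and induction compares the
  rest.\<close>

lemma (in monoid) foldr_mult_mset_cong:
  assumes "mset xs = mset ys" "set xs \<subseteq> carrier G"
    and "\<And>y z. y \<in> set xs \<Longrightarrow> z \<in> set xs \<Longrightarrow> y \<otimes> z = z \<otimes> y"
  shows "foldr (\<otimes>) xs \<one> = foldr (\<otimes>) ys \<one>"
  using assms
proof (induction xs arbitrary: ys)
  case (Cons a xs)
  have S: "set (a # xs) = set ys" using Cons.prems(1) by (rule mset_eq_setD)
  have "mset xs = mset (remove1 a ys)"
    using Cons.prems(1) by (metis add_mset_remove_trivial mset.simps(2) mset_remove1)
  then have "foldr (\<otimes>) xs \<one> = foldr (\<otimes>) (remove1 a ys) \<one>"
    using Cons.IH Cons.prems(2,3) by simp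
  moreover have "foldr (\<otimes>) ys \<one> = a \<otimes> foldr (\<otimes>) (remove1 a ys) \<one>"
    by (rule foldr_mult_remove1) (use S Cons.prems in auto)
  ultimately show ?case by simp
qed simp

lemma k_algebra_smult_closed:
  assumes "k_algebra R" "x \<in> carrier R"
  shows "c \<odot>\<^bsub>R\<^esub> x \<in> carrier R"
proof -
  interpret vectorspace class_ring R using assms by (simp add: k_algebra_def)
  show ?thesis using assms by simp
qed

text \<open>A general \<open>y\<close> lets the lemma be applied twice: with \<open>y = A\<close> a
  factor commutes with \<open>A\<close>, and then with \<open>y\<close> such a factor any two
  factors commute.\<close>

lemma k_algebra_linear_factor_commute:
  assumes R: "k_algebra R" and A: "A \<in> carrier R" and y: "y \<in> carrier R"
    and Ay: "A \<otimes>\<^bsub>R\<^esub> y = y \<otimes>\<^bsub>R\<^esub> A"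
  shows "(c \<odot>\<^bsub>R\<^esub> (A \<ominus>\<^bsub>R\<^esub> (\<mu> \<odot>\<^bsub>R\<^esub> \<one>\<^bsub>R\<^esub>))) \<otimes>\<^bsub>R\<^esub> y = y \<otimes>\<^bsub>R\<^esub> (c \<odot>\<^bsub>R\<^esub> (A \<ominus>\<^bsub>R\<^esub> (\<mu> \<odot>\<^bsub>R\<^esub> \<one>\<^bsub>R\<^esub>)))"
proof -
  interpret ring R using R by (simp add: k_algebra_def)
  have sm: "(c \<odot>\<^bsub>R\<^esub> x) \<otimes>\<^bsub>R\<^esub> z = c \<odot>\<^bsub>R\<^esub> (x \<otimes>\<^bsub>R\<^esub> z)" "x \<otimes>\<^bsub>R\<^esub> (c \<odot>\<^bsub>R\<^esub> z) = c \<odot>\<^bsub>R\<^esub> (x \<otimes>\<^bsub>R\<^esub> z)"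
    if "x \<in> carrier R" "z \<in> carrier R" for c x z
    using R that by (auto simp: k_algebra_def)
  have s: "\<mu> \<odot>\<^bsub>R\<^esub> \<one>\<^bsub>R\<^esub> \<in> carrier R" by (rule k_algebra_smult_closed[OF R]) simp
  have "(A \<ominus>\<^bsub>R\<^esub> (\<mu> \<odot>\<^bsub>R\<^esub> \<one>\<^bsub>R\<^esub>)) \<otimes>\<^bsub>R\<^esub> y = y \<otimes>\<^bsub>R\<^esub> (A \<ominus>\<^bsub>R\<^esub> (\<mu> \<odot>\<^bsub>R\<^esub> \<one>\<^bsub>R\<^esub>))"
    using A y s Ay by (simp add: minus_eq l_distr r_distr l_minus r_minus sm)
  then show ?thesis using A y s by (simp add: sm)
qed

text \<open>Indexing the factors by eigenvalues instead of positions makes the products for two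
  orderings of the spectrum comparable as multisets.\<close>

lemma prim_idem_filter:
  assumes "distinct \<theta>s" "i < length \<theta>s"
  shows "prim_idem R A \<theta>s i =
    foldr (\<otimes>\<^bsub>R\<^esub>)
      (map (\<lambda>\<mu>. inverse (\<theta>s ! i - \<mu>) \<odot>\<^bsub>R\<^esub> (A \<ominus>\<^bsub>R\<^esub> (\<mu> \<odot>\<^bsub>R\<^esub> \<one>\<^bsub>R\<^esub>))) (filter (\<lambda>\<mu>. \<mu> \<noteq> \<theta>s ! i) \<theta>s))
      \<one>\<^bsub>R\<^esub>"
proof -
  have "filter (\<lambda>\<mu>. \<mu> \<noteq> \<theta>s ! i) \<theta>s = filter (\<lambda>\<mu>. \<mu> \<noteq> \<theta>s ! i) (map ((!) \<theta>s) [0..<length \<theta>s])"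
    by (simp add: map_nth)
  also have "\<dots> = map ((!) \<theta>s) (filter (\<lambda>j. \<theta>s ! j \<noteq> \<theta>s ! i) [0..<length \<theta>s])"
    by (simp add: filter_map o_def)
  \<comment> \<open>Distinctness turns inequality of eigenvalues into inequality of
    positions.\<close>
  also have "filter (\<lambda>j. \<theta>s ! j \<noteq> \<theta>s ! i) [0..<length \<theta>s] = filter (\<lambda>j. j \<noteq> i) [0..<length \<theta>s]"
    using assms by (intro filter_cong) (auto simp: nth_eq_iff_index_eq)
  finally show ?thesis by (simp add: prim_idem_def o_def)
qed

lemma prim_idem_cong:
  assumes R: "k_algebra R" and A: "A \<in> carrier R"
    and "distinct \<theta>s" "distinct \<theta>s'" "set \<theta>s = set \<theta>s'"
    and "i < length \<theta>s" "j < length \<theta>s'" "\<theta>s ! i = \<theta>s' ! j"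
  shows "prim_idem R A \<theta>s i = prim_idem R A \<theta>s' j"
proof -
  interpret ring R using R by (simp add: k_algebra_def)
  have fac: "c \<odot>\<^bsub>R\<^esub> (A \<ominus>\<^bsub>R\<^esub> (\<mu> \<odot>\<^bsub>R\<^esub> \<one>\<^bsub>R\<^esub>)) \<in> carrier R" for c \<mu>
    using A by (simp add: k_algebra_smult_closed[OF R])
  have "mset \<theta>s = mset \<theta>s'" using assms set_eq_iff_mset_eq_distinct by blast
  then show ?thesis
    unfolding prim_idem_filter[OF assms(3,6)] prim_idem_filter[OF assms(4,7)] assms(8)
    by (intro foldr_mult_mset_cong)
      (auto simp: fac intro!: k_algebra_linear_factor_commute[OF R A]
        k_algebra_linear_factor_commute[OF R A A, symmetric])
qed

lemma path_order_unique:
  fixes f g :: "nat \<Rightarrow> 'a"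
  assumes "inj_on g {..d}" "f ` {..d} = g ` {..d}" "f 0 = g 0"
    and f: "\<And>i j. i \<le> d \<Longrightarrow> j \<le> d \<Longrightarrow> \<bar>int i - int j\<bar> > 1 \<Longrightarrow> \<not> E (f i) (f j)"
    and g: "\<And>i j. i \<le> d \<Longrightarrow> j \<le> d \<Longrightarrow> \<bar>int i - int j\<bar> = 1 \<Longrightarrow> E (g i) (g j)"
    and "k \<le> d"
  shows "f k = g k"
  using \<open>k \<le> d\<close>
proof (induction k rule: less_induct)
  case (less k)
  show ?case
  proof (cases k)
    case 0
    then show ?thesis using assms(3) by simp
  next
    case (Suc m)
    obtain j where j: "j \<le> d" "g k = f j"
      using assms(2) less.prems by (metis atMost_iff imageE imageI)
    \<comment> \<open>For \<open>j < k\<close> the induction hypothesis would give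
      \<open>g j = f j = g k\<close>, against injectivity of \<open>g\<close>.\<close>
    have "\<not> j < k"
      using less j inj_onD[OF assms(1), of k j] by force
    \<comment> \<open>This is the edge from \<open>g m\<close> to \<open>g k\<close>, rewritten with
      \<open>g m = f m\<close> from the induction hypothesis.\<close>
    moreover have "E (f m) (f j)"
      using g[of m k] less Suc j by simp
    then have "\<not> \<bar>int m - int j\<bar> > 1"
      using f[of m j] less.prems Suc j by auto
    \<comment> \<open>Being within distance 1 of \<open>m = k - 1\<close> and not below
      \<open>k\<close> leaves only \<open>k\<close>.\<close>
    ultimately have "j = k" using Suc by linarith
    then show ?thesis using j by simp
  qed
qed

lemma idempotent_seq_unique:
  fixes R :: "('k::field, 'b) module"
  assumes R: "k_algebra R" and A: "A \<in> carrier R"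
    and Es: "idempotent_seq d R A As Es" "eigenvalue_seq d R A Es \<theta>s"
    and Fs: "idempotent_seq d R A As Fs" "eigenvalue_seq d R A Fs \<phi>s"
    and start: "\<theta>s ! 0 = \<phi>s ! 0"
  shows "Es = Fs"
proof -
  have \<theta>s: "length \<theta>s = d + 1" "distinct \<theta>s" "Es = map (prim_idem R A \<theta>s) [0..<d + 1]"
    and \<phi>s: "length \<phi>s = d + 1" "distinct \<phi>s" "Fs = map (prim_idem R A \<phi>s) [0..<d + 1]"
    and S: "set \<theta>s = set \<phi>s"
    using Es(2) Fs(2) by (auto simp: eigenvalue_seq_def)
  \<comment> \<open>\<open>P \<mu>\<close> is the primitive idempotent for the eigenvalue \<mu>,
    whichever ordering lists it; \<open>SOME\<close> finds the position of \<mu> in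
    \<open>\<phi>s\<close>. The vertices of the path can then be eigenvalues, which are distinct by
    hypothesis.\<close>
  define P where "P \<mu> = prim_idem R A \<phi>s (SOME j. j < d + 1 \<and> \<phi>s ! j = \<mu>)" for \<mu>
  have P: "prim_idem R A \<psi>s i = P (\<psi>s ! i)"
    if "length \<psi>s = d + 1" "distinct \<psi>s" "set \<psi>s = set \<phi>s" "i \<le> d" for \<psi>s i
  proof -
    have "\<exists>j. j < d + 1 \<and> \<phi>s ! j = \<psi>s ! i"
      using that \<phi>s(1) by (metis Suc_eq_plus1 in_set_conv_nth le_imp_less_Suc)
    from someI_ex[OF this] show ?thesis
      unfolding P_def by (intro prim_idem_cong[OF R A]) (use that \<phi>s in auto)
  qed
  have EP: "Es ! i = P (\<theta>s ! i)" "Fs ! i = P (\<phi>s ! i)" if "i \<le> d" for i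
    using P[OF \<theta>s(1,2) S that] P[OF \<phi>s(1,2) refl that] that \<theta>s(3) \<phi>s(3)
    by (simp_all del: upt_Suc)
  have img: "(!) \<psi>s ` {..d} = set (\<psi>s :: 'k list)" if "length \<psi>s = d + 1" for \<psi>s
    using that by (auto simp: set_conv_nth less_Suc_eq_le)
  define E where "E \<mu> \<nu> \<longleftrightarrow> P \<mu> \<otimes>\<^bsub>R\<^esub> As \<otimes>\<^bsub>R\<^esub> P \<nu> \<noteq> \<zero>\<^bsub>R\<^esub>" for \<mu> \<nu>
  have "\<theta>s ! k = \<phi>s ! k" if "k \<le> d" for k
  proof (rule path_order_unique[where E = E and d = d])
    show "inj_on ((!) \<phi>s) {..d}"
      using \<phi>s by (auto simp: inj_on_def nth_eq_iff_index_eq)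
    show "(!) \<theta>s ` {..d} = (!) \<phi>s ` {..d}" using img \<theta>s(1) \<phi>s(1) S by simp
  \<comment> \<open>The non-edges come from the vanishing products for \<open>Es\<close>, the edges
    from the nonvanishing ones for \<open>Fs\<close>.\<close>
  qed (use Es(1) Fs(1) that start in \<open>auto simp: E_def EP[symmetric] idempotent_seq_def\<close>)
  then have "\<theta>s = \<phi>s" using \<theta>s(1) \<phi>s(1) by (intro nth_equalityI) auto
  then show ?thesis using \<theta>s(3) \<phi>s(3) by simp
qed

theorem lemma22p1:
  fixes \<A> :: "('k::field, 'k mat) module" and A Astar :: "'k mat" and d :: nat
  assumes "leonard_pair d \<A> A Astar"
  shows "\<exists>\<^sub>\<le>\<^sub>1 \<Phi>. leonard_system d \<Phi> \<and> associated \<Phi> \<A> A Astar \<and> TD_D_canonical d \<Phi>"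
proof (rule Uniq_I)
  have R: "k_algebra \<A>" and A: "A \<in> carrier \<A>" "Astar \<in> carrier \<A>"
    using assms by (auto simp: leonard_pair_def matrix_algebra_def multiplicity_free_def)
  fix \<Phi> \<Psi> :: "('k, 'k mat) leonard_data"
  assume \<Phi>: "leonard_system d \<Phi> \<and> associated \<Phi> \<A> A Astar \<and> TD_D_canonical d \<Phi>"
    and \<Psi>: "leonard_system d \<Psi> \<and> associated \<Psi> \<A> A Astar \<and> TD_D_canonical d \<Psi>"
  \<comment> \<open>Both initial eigenvalues are expressed through \<open>A\<close> and
    \<open>Astar\<close> alone, so they agree for \<open>\<Phi>\<close> and \<open>\<Psi>\<close>.
    The row sum condition enters at row 0.\<close>
  have canon: "\<exists>\<theta>s \<theta>ss. eigenvalue_seq d \<A> A (idems X) \<theta>s \<and> \<theta>s ! 0 = (\<Sum>j\<le>d. A $$ (0, j)) \<and>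
      eigenvalue_seq d \<A> Astar (dual_idems X) \<theta>ss \<and> \<theta>ss ! 0 = Astar $$ (0, 0)"
    if "associated X \<A> A Astar" "TD_D_canonical d X" for X
    using that unfolding associated_def TD_D_canonical_def by (metis zero_le)
  \<comment> \<open>The dual sequence is handled by the same lemma with \<open>A\<close> and
    \<open>Astar\<close> exchanged.\<close>
  have "idems \<Phi> = idems \<Psi>" "dual_idems \<Phi> = dual_idems \<Psi>"
    using canon[of \<Phi>] canon[of \<Psi>] \<Phi> \<Psi> idempotent_seq_unique[OF R A(1)] idempotent_seq_unique[OF R A(2)]
    unfolding leonard_system_def associated_def by metis+
  then show "\<Phi> = \<Psi>"
    using \<Phi> \<Psi> by (simp add: associated_def)
qed

end
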